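(* Let $x_0\in\mathcal{H}_{\mathrm r}$, $y_0\in\mathcal{H}_{\mathrm u}$ and let $f:J\to\mathcal{H}_{\mathrm r}$, $g:J\to\mathcal{H}_{\mathrm u}$ be continuous. Let $(x,y)$ be a classical solution on $J$ of the block system $$x'(t)=Ax(t)+By(t)+f(t),\qquad y'(t)=Cx(t)+Dy(t)+g(t),\qquad x(0)=x_0,\ y(0)=y_0. \quad ( * )$$ Then the component $x$ satisfies $$x'(t)=Ax(t)+\int_0^tK(t-s)x(s)\,ds+F_{\mathrm u}(t)+f(t),\qquad x(0)=x_0,\quad ( ** )$$ where $$K(t):=BS_D(t)C,\qquad F_{\mathrm u}(t):=BS_D(t)y_0+B\int_0^tS_D(t-s)g(s)\,ds .$$ Conversely, if $x$ is a classical solution of $( ** )$ and $$y(t):=S_D(t)y_0+\int_0^tS_D(t-s)\{Cx(s)+g(s)\}\,ds$$ has sufficient regularity for $( * )$ to be meaningful classically (that is, $y$ is continuous on $J$, continuously differentiable in the interior of $J$, and $y(t)\in D(D)$ for $t$ in the interior of $J$), then $(x,y)$ solves the block system $( * )$.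
   Context: $\mathcal{H}_{\mathrm r}$ and $\mathcal{H}_{\mathrm u}$ are separable real Hilbert spaces. $A:D(A)\subset\mathcal{H}_{\mathrm r}\to\mathcal{H}_{\mathrm r}$ and $D:D(D)\subset\mathcal{H}_{\mathrm u}\to\mathcal{H}_{\mathrm u}$ are possibly unbounded linear operators generating strongly continuous semigroups $S_A(t)$ and $S_D(t)$, respectively. $B:\mathcal{H}_{\mathrm u}\to\mathcal{H}_{\mathrm r}$ and $C:\mathcal{H}_{\mathrm r}\to\mathcal{H}_{\mathrm u}$ are bounded linear operators. $J=[0,\tau)$ with $0<\tau\le\infty$ is a time interval. A classical solution of an evolution equation on $J$ is a function that is continuous on $J$, continuously differentiable in the interior of $J$, takes values in the domain of the respective generator in the interior of $J$ (for a pair: $x(t)\in D(A)$ and $y(t)\in D(D)$), satisfies the equation in the interior of $J$, and attains the initial value. *)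

theory Defs
  imports "HOL-Analysis.Analysis"
begin

text \<open>
  An unbounded operator is a pair of a domain and a total function, whose values outside the
  domain are irrelevant.
\<close>

definition linear_operator :: "'a::real_vector set \<Rightarrow> ('a \<Rightarrow> 'a) \<Rightarrow> bool" where
  "linear_operator D A \<longleftrightarrow>
     subspace D \<and>
     (\<forall>u\<in>D. \<forall>v\<in>D. A (u + v) = A u + A v) \<and>
     (\<forall>c. \<forall>u\<in>D. A (c *\<^sub>R u) = c *\<^sub>R A u)"

text \<open>Semigroups are indexed by all reals, but only their values at times \<open>t \<ge> 0\<close> matter.\<close>

definition C0_semigroup :: "(real \<Rightarrow> 'a \<Rightarrow>\<^sub>L 'a::real_normed_vector) \<Rightarrow> bool" where
  "C0_semigroup S \<longleftrightarrow>
     S 0 = id_blinfun \<and>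
     (\<forall>s\<ge>0. \<forall>t\<ge>0. S (s + t) = S s o\<^sub>L S t) \<and>
     (\<forall>v. ((\<lambda>t. S t v) \<longlongrightarrow> v) (at_right 0))"

text \<open>The domain of the generator is the set of all points where the difference quotient converges.\<close>

definition generates ::
    "'a::real_normed_vector set \<Rightarrow> ('a \<Rightarrow> 'a) \<Rightarrow> (real \<Rightarrow> 'a \<Rightarrow>\<^sub>L 'a) \<Rightarrow> bool" where
  "generates D A S \<longleftrightarrow>
     C0_semigroup S \<and>
     D = {v. \<exists>w. ((\<lambda>h. (S h v - v) /\<^sub>R h) \<longlongrightarrow> w) (at_right 0)} \<and>
     (\<forall>v\<in>D. ((\<lambda>h. (S h v - v) /\<^sub>R h) \<longlongrightarrow> A v) (at_right 0))"

definition time_interval :: "ereal \<Rightarrow> real set" where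
  "time_interval \<tau> = {t. 0 \<le> t \<and> ereal t < \<tau>}"

definition classical_regularity ::
    "real set \<Rightarrow> 'a::real_normed_vector set \<Rightarrow> (real \<Rightarrow> 'a) \<Rightarrow> bool" where
  "classical_regularity J D u \<longleftrightarrow>
     continuous_on J u \<and>
     u C1_differentiable_on (interior J) \<and>
     (\<forall>t\<in>interior J. u t \<in> D)"

text \<open>
  Classical solution of \<open>u' = rhs\<close>, \<open>u 0 = u0\<close>. The right-hand side is a function of time only;
  for an equation in \<open>u\<close> it is instantiated with an expression containing \<open>u\<close> itself.
\<close>

definition classical_solution ::
    "real set \<Rightarrow> 'a::real_normed_vector set \<Rightarrow> (real \<Rightarrow> 'a) \<Rightarrow> 'a \<Rightarrow> (real \<Rightarrow> 'a) \<Rightarrow> bool" where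
  "classical_solution J D rhs u0 u \<longleftrightarrow>
     classical_regularity J D u \<and>
     (\<forall>t\<in>interior J. (u has_vector_derivative rhs t) (at t)) \<and>
     u 0 = u0"

definition block_solution ::
    "real set \<Rightarrow> 'r::real_normed_vector set \<Rightarrow> ('r \<Rightarrow> 'r) \<Rightarrow> ('u \<Rightarrow>\<^sub>L 'r) \<Rightarrow> ('r \<Rightarrow>\<^sub>L 'u)
      \<Rightarrow> 'u::real_normed_vector set \<Rightarrow> ('u \<Rightarrow> 'u) \<Rightarrow> (real \<Rightarrow> 'r) \<Rightarrow> (real \<Rightarrow> 'u)
      \<Rightarrow> 'r \<Rightarrow> 'u \<Rightarrow> (real \<Rightarrow> 'r) \<Rightarrow> (real \<Rightarrow> 'u) \<Rightarrow> bool" where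
  "block_solution J dom_A A B C dom_D D f g x0 y0 x y \<longleftrightarrow>
     classical_solution J dom_A (\<lambda>t. A (x t) + B (y t) + f t) x0 x \<and>
     classical_solution J dom_D (\<lambda>t. C (x t) + D (y t) + g t) y0 y"

definition memory_kernel ::
    "('u::real_normed_vector \<Rightarrow>\<^sub>L 'r::real_normed_vector) \<Rightarrow> (real \<Rightarrow> 'u \<Rightarrow>\<^sub>L 'u)
      \<Rightarrow> ('r \<Rightarrow>\<^sub>L 'u) \<Rightarrow> real \<Rightarrow> 'r \<Rightarrow>\<^sub>L 'r" where
  "memory_kernel B S C t = B o\<^sub>L S t o\<^sub>L C"

text \<open>
  For continuous data all integrands below are norm-continuous on \<open>{0..t}\<close>, so that the
  Henstock--Kurzweil integral is the Riemann (and the Bochner) integral.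
\<close>

definition mild_solution ::
    "(real \<Rightarrow> 'u \<Rightarrow>\<^sub>L 'u) \<Rightarrow> 'u \<Rightarrow> (real \<Rightarrow> 'u) \<Rightarrow> real \<Rightarrow> 'u::banach" where
  "mild_solution S y0 h t = S t y0 + integral {0..t} (\<lambda>s. S (t - s) (h s))"

definition unresolved_force ::
    "('u \<Rightarrow>\<^sub>L 'r) \<Rightarrow> (real \<Rightarrow> 'u \<Rightarrow>\<^sub>L 'u) \<Rightarrow> 'u \<Rightarrow> (real \<Rightarrow> 'u::banach) \<Rightarrow> real
      \<Rightarrow> 'r::real_normed_vector" where
  "unresolved_force B S y0 g t = B (S t y0) + B (integral {0..t} (\<lambda>s. S (t - s) (g s)))"

definition memory_solution ::
    "real set \<Rightarrow> 'r::banach set \<Rightarrow> ('r \<Rightarrow> 'r) \<Rightarrow> ('u \<Rightarrow>\<^sub>L 'r) \<Rightarrow> ('r \<Rightarrow>\<^sub>L 'u)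
      \<Rightarrow> (real \<Rightarrow> 'u \<Rightarrow>\<^sub>L 'u) \<Rightarrow> (real \<Rightarrow> 'r) \<Rightarrow> (real \<Rightarrow> 'u::banach)
      \<Rightarrow> 'r \<Rightarrow> 'u \<Rightarrow> (real \<Rightarrow> 'r) \<Rightarrow> bool" where
  "memory_solution J dom_A A B C S f g x0 y0 x \<longleftrightarrow>
     classical_solution J dom_A
       (\<lambda>t. A (x t) + integral {0..t} (\<lambda>s. memory_kernel B S C (t - s) (x s))
            + unresolved_force B S y0 g t + f t) x0 x"

end

theory Submission
  imports Defs
begin

text \<open>
  A classical solution of \<open>y' = D y + h\<close> satisfies
  \<open>d/ds S(t - s) y(s) = S(t - s) h(s)\<close>, and integration over \<open>[0, t]\<close> gives the mild solution
  formula; inserting it into the equation for \<open>x\<close> turns \<open>B y\<close> into the memory term plus the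
  unresolved force. Conversely, for a mild solution
  \<open>y(t + k) = S(k) y(t) + \<integral>\<^sub>t\<^sup>t\<^sup>+\<^sup>k S(t + k - s) h(s) ds\<close> with \<open>k > 0\<close>, so at a time where \<open>y\<close> is
  differentiable and lies in the domain of \<open>D\<close> the right difference quotient identifies the
  derivative as \<open>D y(t) + h(t)\<close>. Both limits rest on the joint continuity of
  \<open>(r, v) \<mapsto> S(r) v\<close>, which comes from the uniform boundedness principle.
\<close>

section \<open>Baire category and uniform boundedness\<close>

text \<open>
  The index sets depend on \<open>n\<close> because strong continuity of a semigroup at \<open>0\<close> bounds \<open>S t v\<close> only
  on a time interval that depends on \<open>v\<close>.
\<close>

lemma uniform_boundedness:
  fixes T :: "'i \<Rightarrow> 'a::banach \<Rightarrow>\<^sub>L 'b::real_normed_vector" and I :: "nat \<Rightarrow> 'i set"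
  assumes pointwise: "\<And>v. \<exists>n. \<forall>i\<in>I n. norm (T i v) \<le> real n"
  obtains n M where "\<And>i. i \<in> I n \<Longrightarrow> norm (T i) \<le> M"
proof -
  define E where "E n = (\<Inter>i\<in>I n. {v. norm (T i v) \<le> real n})" for n
  have closed_E: "closed (E n)" for n
    unfolding E_def
    by (intro closed_INT ballI closed_Collect_le continuous_intros)
  have "\<Union>(range E) = UNIV"
    using pointwise by (auto simp: E_def)
  \<comment> \<open>The closed sets \<open>E n\<close> cover the whole Banach space, so by Baire's
    theorem they cannot all have empty interior.\<close>
  moreover have "interior (\<Union>(range E)) = {}" if "\<And>n. interior (E n) = {}"
    using Met_TC.metric_Baire_category_alt[of "range E"] that closed_E
    by (auto simp: complete_UNIV)
  ultimately obtain n where "interior (E n) \<noteq> {}"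
    by force
  then obtain v e where "e > 0" and ball: "cball v e \<subseteq> E n"
    by (metis ex_in_conv mem_interior_cball)
  \<comment> \<open>A vector of norm \<open>e\<close> is the difference of two points of the ball,
    both with images of norm at most \<open>n\<close>; scaling by \<open>norm u / e\<close> gives
    the constant.\<close>
  have "norm (T i) \<le> 2 * real n / e" if "i \<in> I n" for i
  proof (rule norm_blinfun_bound)
    fix u :: 'a
    show "norm (T i u) \<le> 2 * real n / e * norm u"
    proof (cases "u = 0")
      case False
      define w where "w = (e / norm u) *\<^sub>R u"
      have "v \<in> E n" "v + w \<in> E n"
        using ball \<open>e > 0\<close> False by (auto simp: w_def dist_norm)
      then have "norm (T i v) \<le> real n" "norm (T i (v + w)) \<le> real n"
        using that by (auto simp: E_def)
      then have "norm (T i (v + w) - T i v) \<le> 2 * real n"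
        using norm_triangle_ineq4[of "T i (v + w)" "T i v"] by linarith
      then have "norm (T i w) \<le> 2 * real n"
        by (simp add: blinfun.add_right)
      then show ?thesis
        using \<open>e > 0\<close> False by (simp add: w_def blinfun.scaleR_right field_simps)
    qed simp
  qed (use \<open>e > 0\<close> in simp)
  then show ?thesis
    by (rule that)
qed

section \<open>Local boundedness and joint continuity of semigroups\<close>

lemma C0_semigroup_add:
  assumes "C0_semigroup S" "0 \<le> s" "0 \<le> t"
  shows "S (s + t) v = S s (S t v)"
  using assms by (simp add: C0_semigroup_def)

lemma C0_semigroup_0:
  assumes "C0_semigroup S"
  shows "S 0 v = v"
  using assms by (simp add: C0_semigroup_def)

text \<open>Strong continuity at 0 bounds each orbit by \<open>norm v + 1\<close> on an interval
  whose length depends on \<open>v\<close>; the uniform boundedness principle turns this into a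
  bound in operator norm.\<close>

lemma C0_semigroup_locally_bounded:
  fixes S :: "real \<Rightarrow> 'a::banach \<Rightarrow>\<^sub>L 'a"
  assumes "C0_semigroup S"
  obtains d M where "0 < d" "\<And>t. 0 \<le> t \<Longrightarrow> t \<le> d \<Longrightarrow> norm (S t) \<le> M"
proof -
  have "\<exists>n. \<forall>t\<in>{0..1 / real (Suc n)}. norm (S t v) \<le> real n" for v
  proof -
    have "((\<lambda>t. S t v) \<longlongrightarrow> v) (at_right 0)"
      using assms by (simp add: C0_semigroup_def)
    then have "\<forall>\<^sub>F t in at_right 0. dist (S t v) v < 1"
      by (rule tendstoD) simp
    then obtain d where d: "d > 0" "\<And>t. 0 < t \<Longrightarrow> t < d \<Longrightarrow> dist (S t v) v < 1"
      by (auto simp: eventually_at_right_field)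
    have le: "norm (S t v) \<le> norm v + 1" if "0 \<le> t" "t < d" for t
    proof (cases "t = 0")
      case False
      then show ?thesis
        using d(2)[of t] that norm_triangle_ineq2[of "S t v" v] by (simp add: dist_norm)
    qed (simp add: C0_semigroup_0[OF assms])
    \<comment> \<open>The same \<open>n\<close> must bound the orbit and make the interval of length
      \<open>1 / real (Suc n)\<close> short enough; exceeding the sum of both requirements achieves
      this.\<close>
    obtain n where n: "norm v + 1 + 1 / d < real n"
      using reals_Archimedean2 by blast
    have "norm v + 1 \<le> real n" "1 / d < real (Suc n)"
      using n \<open>d > 0\<close> norm_ge_zero[of v] divide_pos_pos[of 1 d] by linarith+
    then have "norm v + 1 \<le> real n" "1 / real (Suc n) < d"
      using \<open>d > 0\<close> by (simp_all add: field_simps)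
    then show ?thesis
      using le by (intro exI[of _ n]) force
  qed
  then obtain n M where "\<And>t. t \<in> {0..1 / real (Suc n)} \<Longrightarrow> norm (S t) \<le> M"
    by (rule uniform_boundedness[of "\<lambda>n. {0..1 / real (Suc n)}" S]) blast
  then show ?thesis
    by (intro that[of "1 / real (Suc n)" M]) auto
qed

text \<open>The semigroup law reaches any time up to \<open>a\<close> by finitely many steps of
  length at most \<open>d\<close>, each of which costs a factor \<open>M\<close>.\<close>

lemma C0_semigroup_bounded:
  fixes S :: "real \<Rightarrow> 'a::banach \<Rightarrow>\<^sub>L 'a"
  assumes S: "C0_semigroup S"
  obtains M where "0 \<le> M" "\<And>t. 0 \<le> t \<Longrightarrow> t \<le> a \<Longrightarrow> norm (S t) \<le> M"
proof -
  obtain d M where "0 < d" and M: "\<And>t. 0 \<le> t \<Longrightarrow> t \<le> d \<Longrightarrow> norm (S t) \<le> M"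
    using C0_semigroup_locally_bounded[OF S] by blast
  have "0 \<le> M"
    using M[of 0] \<open>0 < d\<close> norm_ge_zero[of "S 0"] by linarith
  have bound: "norm (S t) \<le> M ^ Suc n" if "0 \<le> t" "t \<le> real (Suc n) * d" for n t
    using that
  proof (induction n arbitrary: t)
    case 0
    then show ?case using M by simp
  next
    case (Suc n)
    \<comment> \<open>For \<open>t < d\<close> the remaining time \<open>t - r\<close> is 0, which
      the induction hypothesis covers too, so short times need no separate argument.\<close>
    define r where "r = min d t"
    have r: "0 \<le> r" "r \<le> d" "0 \<le> t - r" "t - r \<le> real (Suc n) * d"
      using Suc.prems \<open>0 < d\<close> by (auto simp: r_def min_def algebra_simps)
    have "S t = S r o\<^sub>L S (t - r)"
      using S r by (metis C0_semigroup_def add_diff_cancel_left' add.commute diff_add_cancel)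
    then have "norm (S t) \<le> norm (S r) * norm (S (t - r))"
      by (simp add: norm_blinfun_compose)
    also have "\<dots> \<le> M * M ^ Suc n"
      using M r Suc.IH \<open>0 \<le> M\<close> by (intro mult_mono) auto
    finally show ?case by simp
  qed
  obtain n where "a / d < real n"
    using reals_Archimedean2 by blast
  then have "a \<le> real (Suc n) * d"
    using \<open>0 < d\<close> by (simp add: field_simps)
  then show ?thesis
    using bound[of _ n] \<open>0 \<le> M\<close> by (intro that[of "M ^ Suc n"]) auto
qed

text \<open>The difference splits into \<open>S (r x) (v x - w)\<close>, controlled by the uniform
  bound near \<open>a\<close>, and \<open>S (r x) w - S a w\<close>, controlled by strong
  continuity. A general filter lets one statement serve continuity on sets as well as difference
  quotients.\<close>

lemma C0_semigroup_tendsto: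
  fixes S :: "real \<Rightarrow> 'a::banach \<Rightarrow>\<^sub>L 'a"
  assumes S: "C0_semigroup S"
    and v: "(v \<longlongrightarrow> w) F" and r: "(r \<longlongrightarrow> a) F" and "0 \<le> a" and nonneg: "\<forall>\<^sub>F x in F. 0 \<le> r x"
  shows "((\<lambda>x. S (r x) (v x)) \<longlongrightarrow> S a w) F"
proof -
  obtain M where "0 \<le> M" and M: "\<And>t. 0 \<le> t \<Longrightarrow> t \<le> a + 1 \<Longrightarrow> norm (S t) \<le> M"
    using C0_semigroup_bounded[OF S, of "a + 1"] by blast
  \<comment> \<open>Factoring out \<open>S (min t a)\<close> treats times before and after
    \<open>a\<close> alike and reduces the estimate to strong continuity from the right at
    0.\<close>
  have diff: "norm (S t w - S a w) \<le> M * norm (S \<bar>t - a\<bar> w - w)" if "0 \<le> t" "t \<le> a + 1" for t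
  proof -
    define m where "m = min t a"
    have m: "0 \<le> m" "m \<le> a + 1"
      using that \<open>0 \<le> a\<close> by (auto simp: m_def)
    have "norm (S t w - S a w) = norm (S m (S \<bar>t - a\<bar> w) - S m w)"
      using that \<open>0 \<le> a\<close> C0_semigroup_add[OF S, of m "\<bar>t - a\<bar>" w]
      by (cases "t \<le> a") (auto simp: m_def norm_minus_commute)
    also have "\<dots> \<le> norm (S m) * norm (S \<bar>t - a\<bar> w - w)"
      using norm_blinfun[of "S m" "S \<bar>t - a\<bar> w - w"] by (simp add: blinfun.diff_right)
    also have "\<dots> \<le> M * norm (S \<bar>t - a\<bar> w - w)"
      using M[OF m] by (intro mult_right_mono) auto
    finally show ?thesis .
  qed
  have le1: "\<forall>\<^sub>F x in F. r x \<le> a + 1"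
    using order_tendstoD(2)[OF r, of "a + 1"] by (auto elim: eventually_mono)
  \<comment> \<open>The time \<open>\<bar>r x - a\<bar>\<close> may vanish, so continuity at 0
    within the closed half-line is composed instead of a limit along
    \<open>at_right 0\<close>.\<close>
  have "continuous (at 0 within {0..}) (\<lambda>t. S t w)"
    using S by (simp add: C0_semigroup_def continuous_within at_within_Ici_at_right)
  moreover have "((\<lambda>x. \<bar>r x - a\<bar>) \<longlongrightarrow> 0) F"
    using r by (intro tendsto_rabs_zero) (simp add: LIM_zero)
  ultimately have Sw: "((\<lambda>x. S \<bar>r x - a\<bar> w) \<longlongrightarrow> S 0 w) F"
    by (intro continuous_within_tendsto_compose[of 0 "{0..}" "\<lambda>t. S t w"]) simp_all
  have lim: "((\<lambda>x. M * norm (v x - w) + M * norm (S \<bar>r x - a\<bar> w - w)) \<longlongrightarrow> M * norm (w - w) + M * norm (S 0 w - w)) F"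
    by (intro tendsto_add tendsto_mult_left tendsto_norm tendsto_diff tendsto_const v Sw)
  have "((\<lambda>x. S (r x) (v x) - S a w) \<longlongrightarrow> 0) F"
  proof (rule Lim_null_comparison)
    show "\<forall>\<^sub>F x in F. norm (S (r x) (v x) - S a w)
      \<le> M * norm (v x - w) + M * norm (S \<bar>r x - a\<bar> w - w)"
      using le1 nonneg
    proof eventually_elim
      case (elim x)
      have "norm (S (r x) (v x) - S a w) \<le> norm (S (r x) (v x - w)) + norm (S (r x) w - S a w)"
        using norm_triangle_ineq[of "S (r x) (v x - w)" "S (r x) w - S a w"]
        by (simp add: blinfun.diff_right)
      moreover have "norm (S (r x) (v x - w)) \<le> M * norm (v x - w)"
        using norm_blinfun[of "S (r x)" "v x - w"] M[of "r x"] elim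
          mult_right_mono[of "norm (S (r x))" M "norm (v x - w)"] by force
      ultimately show ?case
        using diff[of "r x"] elim by linarith
    qed
    show "((\<lambda>x. M * norm (v x - w) + M * norm (S \<bar>r x - a\<bar> w - w)) \<longlongrightarrow> 0) F"
      using lim by (simp add: C0_semigroup_0[OF S])
  qed
  then show ?thesis
    by (rule LIM_zero_cancel)
qed

lemma C0_semigroup_continuous_on:
  fixes S :: "real \<Rightarrow> 'a::banach \<Rightarrow>\<^sub>L 'a"
  assumes "C0_semigroup S" "continuous_on X v" "continuous_on X r" "\<And>x. x \<in> X \<Longrightarrow> 0 \<le> r x"
  shows "continuous_on X (\<lambda>x. S (r x) (v x))"
  unfolding continuous_on
proof
  fix x assume "x \<in> X"
  moreover have "\<forall>\<^sub>F x' in at x within X. x' \<in> X"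
    by (auto simp: eventually_at_filter)
  then have "\<forall>\<^sub>F x' in at x within X. 0 \<le> r x'"
    by eventually_elim (use assms in auto)
  ultimately show "((\<lambda>x. S (r x) (v x)) \<longlongrightarrow> S (r x) (v x)) (at x within X)"
    using assms by (intro C0_semigroup_tendsto) (auto simp: continuous_on)
qed

lemma C0_semigroup_convolution_continuous_on:
  fixes S :: "real \<Rightarrow> 'a::banach \<Rightarrow>\<^sub>L 'a"
  assumes "C0_semigroup S" "continuous_on {a..b} h" "b \<le> t"
  shows "continuous_on {a..b} (\<lambda>s. S (t - s) (h s))"
proof (rule C0_semigroup_continuous_on[OF assms(1,2)])
  show "continuous_on {a..b} (\<lambda>s. t - s)"
    by (intro continuous_intros)
qed (use assms(3) in auto)

lemma C0_semigroup_convolution_integrable: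
  fixes S :: "real \<Rightarrow> 'a::banach \<Rightarrow>\<^sub>L 'a"
  assumes "C0_semigroup S" "continuous_on {a..b} h" "b \<le> t"
  shows "(\<lambda>s. S (t - s) (h s)) integrable_on {a..b}"
  by (rule integrable_continuous_interval[OF C0_semigroup_convolution_continuous_on[OF assms]])

section \<open>Differentiation along semigroup orbits\<close>

text \<open>Quotients by \<open>k\<close> match the limit in \<open>generates\<close>, and the
  filter \<open>at 0\<close> splits into two sides, on which the semigroup law is used
  differently.\<close>

lemma has_vector_derivative_at_iff_LIM:
  fixes f :: "real \<Rightarrow> 'a::real_normed_vector"
  shows "(f has_vector_derivative d) (at t) \<longleftrightarrow> ((\<lambda>k. (f (t + k) - f t) /\<^sub>R k) \<longlongrightarrow> d) (at 0)"
proof -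
  have "(f has_vector_derivative d) (at t) \<longleftrightarrow>
      ((\<lambda>k. norm (f (t + k) - f t - k *\<^sub>R d) / norm k) \<longlongrightarrow> 0) (at 0)"
    by (simp add: has_vector_derivative_def has_derivative_at bounded_linear_scaleR_left)
  also have "\<dots> \<longleftrightarrow> ((\<lambda>k. norm ((f (t + k) - f t) /\<^sub>R k - d)) \<longlongrightarrow> 0) (at 0)"
  proof (rule filterlim_cong[OF refl refl])
    show "\<forall>\<^sub>F k in at 0. norm (f (t + k) - f t - k *\<^sub>R d) / norm k
        = norm ((f (t + k) - f t) /\<^sub>R k - d)"
    proof (rule eventually_mono[OF eventually_neq_at_within[of 0]])
      fix k :: real assume "k \<noteq> 0"
      then have "(f (t + k) - f t) /\<^sub>R k - d = (f (t + k) - f t - k *\<^sub>R d) /\<^sub>R k"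
        by (simp add: scaleR_diff_right)
      then show "norm (f (t + k) - f t - k *\<^sub>R d) / norm k = norm ((f (t + k) - f t) /\<^sub>R k - d)"
        by (simp add: divide_inverse mult.commute)
    qed
  qed
  also have "\<dots> \<longleftrightarrow> ((\<lambda>k. (f (t + k) - f t) /\<^sub>R k) \<longlongrightarrow> d) (at 0)"
    by (simp add: tendsto_norm_zero_iff LIM_zero_iff)
  finally show ?thesis .
qed

text \<open>To the right, \<open>S r\<close> is pulled out of the quotient that defines the
  generator. To the left, \<open>S (r - k)\<close> acts on that quotient, so operator and argument
  both vary and joint continuity gives the limit. The form \<open>S r (A v)\<close> keeps the
  invariance of the domain under the semigroup out of the argument.\<close>

lemma generates_has_vector_derivative:
  fixes S :: "real \<Rightarrow> 'a::banach \<Rightarrow>\<^sub>L 'a"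
  assumes gen: "generates dom_A A S" and v: "v \<in> dom_A" and "0 < r"
  shows "((\<lambda>r. S r v) has_vector_derivative S r (A v)) (at r)"
proof -
  have S: "C0_semigroup S" and lim: "((\<lambda>h. (S h v - v) /\<^sub>R h) \<longlongrightarrow> A v) (at_right 0)"
    using gen v by (auto simp: generates_def)
  have "((\<lambda>k. (S (r + k) v - S r v) /\<^sub>R k) \<longlongrightarrow> S r (A v)) (at_right 0)"
  proof (rule Lim_transform_eventually)
    show "((\<lambda>k. S r ((S k v - v) /\<^sub>R k)) \<longlongrightarrow> S r (A v)) (at_right 0)"
      by (intro tendsto_intros lim)
    show "\<forall>\<^sub>F k in at_right 0. S r ((S k v - v) /\<^sub>R k) = (S (r + k) v - S r v) /\<^sub>R k"
      using eventually_at_right_less[of 0]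
      by eventually_elim
        (use \<open>0 < r\<close> in \<open>simp add: C0_semigroup_add[OF S] blinfun.diff_right blinfun.scaleR_right\<close>)
  qed
  moreover have "((\<lambda>k. (S (r + k) v - S r v) /\<^sub>R k) \<longlongrightarrow> S r (A v)) (at_left 0)"
    unfolding at_left_minus[of 0] filterlim_filtermap minus_zero
  proof (rule Lim_transform_eventually)
    have "((\<lambda>k. r - k) \<longlongrightarrow> r - 0) (at_right 0)"
      by (intro tendsto_intros)
    moreover have small: "\<forall>\<^sub>F k in at_right 0. k < r"
      using \<open>0 < r\<close> by (simp add: eventually_at_right_less eventually_at_right_field) blast
    then have "\<forall>\<^sub>F k in at_right 0. 0 \<le> r - k"
      by eventually_elim simp
    ultimately show "((\<lambda>k. S (r - k) ((S k v - v) /\<^sub>R k)) \<longlongrightarrow> S r (A v)) (at_right 0)"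
      using \<open>0 < r\<close> by (intro C0_semigroup_tendsto[OF S lim]) auto
    show "\<forall>\<^sub>F k in at_right 0.
        S (r - k) ((S k v - v) /\<^sub>R k) = (S (r + - k) v - S r v) /\<^sub>R - k"
      using eventually_at_right_less[of 0] small
    proof eventually_elim
      case (elim k)
      then have "S r v = S (r - k) (S k v)"
        using C0_semigroup_add[OF S, of "r - k" k v] by simp
      then show ?case
        by (simp add: blinfun.diff_right blinfun.scaleR_right scaleR_diff_right)
    qed
  qed
  ultimately show ?thesis
    by (simp add: has_vector_derivative_at_iff_LIM filterlim_at_split)
qed

text \<open>A product rule for a merely strongly continuous family: the increment is the operator at
  the moved time acting on the increment of \<open>y\<close>, handled by joint continuity, plus the
  increment of the operator on the fixed vector \<open>y s\<close>, handled by the generator. The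
  strict \<open>s < t\<close> keeps the orbit time positive for two-sided differentiation.\<close>

lemma generates_convolution_derivative:
  fixes S :: "real \<Rightarrow> 'a::banach \<Rightarrow>\<^sub>L 'a"
  assumes gen: "generates dom_A A S" and dom: "y s \<in> dom_A" and "s < t"
    and y: "(y has_vector_derivative y') (at s)"
  shows "((\<lambda>s. S (t - s) (y s)) has_vector_derivative S (t - s) (y' - A (y s))) (at s)"
proof -
  have S: "C0_semigroup S"
    using gen by (simp add: generates_def)
  have "((\<lambda>r. S r (y s)) has_vector_derivative S (t - s) (A (y s))) (at (t - s))"
    using generates_has_vector_derivative[OF gen dom] \<open>s < t\<close> by simp
  moreover have "((\<lambda>q. t - q) has_vector_derivative - 1) (at s)"
    by (auto intro!: derivative_eq_intros)
  ultimately have "((\<lambda>q. S (t - q) (y s)) has_vector_derivative - S (t - s) (A (y s))) (at s)"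
    using vector_diff_chain_at[of "\<lambda>q. t - q" "-1" s "\<lambda>r. S r (y s)"] by (simp add: o_def)
  then have lim1: "((\<lambda>k. (S (t - (s + k)) (y s) - S (t - s) (y s)) /\<^sub>R k)
      \<longlongrightarrow> - S (t - s) (A (y s))) (at 0)"
    by (simp add: has_vector_derivative_at_iff_LIM)
  have lim: "((\<lambda>k. t - (s + k)) \<longlongrightarrow> t - (s + 0)) (at 0)"
    by (intro tendsto_intros)
  have "\<forall>\<^sub>F k in at 0. 0 < t - (s + k)"
    by (rule order_tendstoD(1)[OF lim]) (use \<open>s < t\<close> in simp)
  then have "\<forall>\<^sub>F k in at 0. 0 \<le> t - (s + k)"
    by eventually_elim simp
  then have lim2: "((\<lambda>k. S (t - (s + k)) ((y (s + k) - y s) /\<^sub>R k)) \<longlongrightarrow> S (t - s) y') (at 0)"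
    using y lim \<open>s < t\<close>
    by (intro C0_semigroup_tendsto[OF S]) (auto simp: has_vector_derivative_at_iff_LIM)
  show ?thesis
    using tendsto_add[OF lim2 lim1]
    by (simp add: has_vector_derivative_at_iff_LIM blinfun.diff_right blinfun.scaleR_right
        scaleR_diff_right algebra_simps)
qed

section \<open>Classical and mild solutions\<close>

lemma classical_imp_mild:
  fixes S :: "real \<Rightarrow> 'a::banach \<Rightarrow>\<^sub>L 'a"
  assumes gen: "generates dom_A A S" and "0 \<le> t"
    and cont: "continuous_on {0..t} y" and dom: "\<And>s. s \<in> {0<..<t} \<Longrightarrow> y s \<in> dom_A"
    and deriv: "\<And>s. s \<in> {0<..<t} \<Longrightarrow> (y has_vector_derivative A (y s) + h s) (at s)"
  shows "y t = mild_solution S (y 0) h t"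
proof -
  have S: "C0_semigroup S"
    using gen by (simp add: generates_def)
  \<comment> \<open>The terms with \<open>A\<close> cancel in the derivative. It is known on the
    open interval only, hence the interior version of the fundamental theorem, which asks for mere
    continuity at the end points.\<close>
  have "((\<lambda>s. S (t - s) (h s)) has_integral S (t - t) (y t) - S (t - 0) (y 0)) {0..t}"
  proof (rule fundamental_theorem_of_calculus_interior[OF \<open>0 \<le> t\<close>])
    show "continuous_on {0..t} (\<lambda>s. S (t - s) (y s))"
      by (intro C0_semigroup_continuous_on[OF S] cont continuous_intros) auto
    show "((\<lambda>s. S (t - s) (y s)) has_vector_derivative S (t - s) (h s)) (at s)"
      if "s \<in> {0<..<t}" for s
      using generates_convolution_derivative[OF gen dom[OF that] _ deriv[OF that], of t] that by simp
  qed
  then show ?thesis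
    by (auto simp: mild_solution_def C0_semigroup_0[OF S] dest!: integral_unique)
qed

text \<open>On \<open>{0..t}\<close> the factor \<open>S k\<close> splits off by the semigroup law
  and, being bounded, commutes with the integral; this restarts the evolution at time
  \<open>t\<close>.\<close>

lemma mild_solution_add:
  fixes S :: "real \<Rightarrow> 'a::banach \<Rightarrow>\<^sub>L 'a"
  assumes S: "C0_semigroup S" and "0 \<le> t" "0 \<le> k" and h: "continuous_on {0..t + k} h"
  shows "mild_solution S y0 h (t + k)
    = S k (mild_solution S y0 h t) + integral {t..t + k} (\<lambda>s. S (t + k - s) (h s))"
proof -
  have "S (t + k - s) (h s) = S k (S (t - s) (h s))" if "s \<in> {0..t}" for s
    using C0_semigroup_add[OF S \<open>0 \<le> k\<close>, of "t - s"] that by (simp add: algebra_simps)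
  then have "integral {0..t} (\<lambda>s. S (t + k - s) (h s)) = integral {0..t} (\<lambda>s. S k (S (t - s) (h s)))"
    by (rule integral_cong)
  also have "\<dots> = S k (integral {0..t} (\<lambda>s. S (t - s) (h s)))"
    using integral_linear[OF C0_semigroup_convolution_integrable[OF S continuous_on_subset[OF h]]
        blinfun.bounded_linear_right, of 0 t t "S k"] \<open>0 \<le> k\<close>
    by (simp add: o_def)
  finally have "integral {0..t + k} (\<lambda>s. S (t + k - s) (h s)) =
      S k (integral {0..t} (\<lambda>s. S (t - s) (h s))) + integral {t..t + k} (\<lambda>s. S (t + k - s) (h s))"
    using Henstock_Kurzweil_Integration.integral_combine[OF _ _ C0_semigroup_convolution_integrable[OF S h order.refl], of t]
      assms by simp
  then show ?thesis
    using assms C0_semigroup_add[OF S, of k t y0]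
    by (simp add: mild_solution_def blinfun.add_right add.commute)
qed

text \<open>Integrand and interval both depend on \<open>k\<close>. As \<open>k\<close> shrinks, all
  pairs \<open>(t + k - s, s)\<close> approach \<open>(0, t)\<close>, where joint continuity brings
  the integrand close to \<open>S 0 (h t) = h t\<close>.\<close>

lemma convolution_average_tendsto:
  fixes S :: "real \<Rightarrow> 'a::banach \<Rightarrow>\<^sub>L 'a"
  assumes S: "C0_semigroup S" and h: "continuous_on {t..b} h" and "t < b"
  shows "((\<lambda>k. integral {t..t + k} (\<lambda>s. S (t + k - s) (h s)) /\<^sub>R k) \<longlongrightarrow> h t) (at_right 0)"
proof (rule tendstoI)
  fix e :: real assume "0 < e"
  define G where "G p = S (fst p) (h (snd p))" for p
  have "continuous_on ({0..} \<times> {t..b}) (\<lambda>p. h (snd p))"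
    by (rule continuous_on_compose2[OF h continuous_on_snd[OF continuous_on_id]]) auto
  then have "continuous_on ({0..} \<times> {t..b}) G"
    unfolding G_def
    by (rule C0_semigroup_continuous_on[OF S _ continuous_on_fst[OF continuous_on_id]]) auto
  moreover have "(0, t) \<in> {0::real..} \<times> {t..b}" "0 < e / 2"
    using \<open>0 < e\<close> \<open>t < b\<close> by simp_all
  ultimately obtain d where "0 < d" and d: "\<And>p. p \<in> {0..} \<times> {t..b} \<Longrightarrow> dist p (0, t) < d \<Longrightarrow>
      dist (G p) (G (0, t)) < e / 2"
    unfolding continuous_on_iff by blast
  \<comment> \<open>Both coordinates deviate from \<open>(0, t)\<close> by at most \<open>k\<close>,
    so \<open>k < d / 2\<close> keeps the pairs within \<open>d\<close>, and
    \<open>k < b - t\<close> keeps the integration inside \<open>{t..b}\<close>.\<close>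
  have *: "dist (integral {t..t + k} (\<lambda>s. S (t + k - s) (h s)) /\<^sub>R k) (h t) < e"
    if k: "0 < k" "k < min (d / 2) (b - t)" for k
  proof -
    have h_k: "continuous_on {t..t + k} h"
      using k by (intro continuous_on_subset[OF h]) auto
    note int = C0_semigroup_convolution_integrable[OF S h_k order.refl]
    have "norm (integral {t..t + k} (\<lambda>s. S (t + k - s) (h s)) - k *\<^sub>R h t) \<le> e / 2 * (t + k - t)"
    proof -
      have "continuous_on {t..t + k} (\<lambda>s. S (t + k - s) (h s) - h t)"
        by (intro continuous_on_diff continuous_on_const
            C0_semigroup_convolution_continuous_on[OF S h_k order.refl])
      moreover have "norm (S (t + k - s) (h s) - h t) \<le> e / 2" if "s \<in> {t..t + k}" for s
      proof -
        have "dist (t + k - s, s) (0, t) \<le> \<bar>t + k - s\<bar> + \<bar>s - t\<bar>"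
          unfolding dist_Pair_Pair dist_real_def
          using sqrt_sum_squares_le_sum_abs[of "t + k - s" "s - t"] by simp
        then show ?thesis
          using d[of "(t + k - s, s)"] that k
          by (simp add: dist_norm G_def C0_semigroup_0[OF S])
      qed
      ultimately have "norm (integral {t..t + k} (\<lambda>s. S (t + k - s) (h s) - h t))
          \<le> e / 2 * (t + k - t)"
        using k by (intro integral_bound) auto
      then show ?thesis
        using k by (simp add: Henstock_Kurzweil_Integration.integral_diff[OF int integrable_const_ivl])
    qed
    moreover have "dist (integral {t..t + k} (\<lambda>s. S (t + k - s) (h s)) /\<^sub>R k) (h t) =
        norm (integral {t..t + k} (\<lambda>s. S (t + k - s) (h s)) - k *\<^sub>R h t) / k"
    proof -
      have "integral {t..t + k} (\<lambda>s. S (t + k - s) (h s)) /\<^sub>R k - h t =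
          (integral {t..t + k} (\<lambda>s. S (t + k - s) (h s)) - k *\<^sub>R h t) /\<^sub>R k"
        using k by (simp add: scaleR_diff_right)
      then show ?thesis
        using k(1) by (simp only: dist_norm norm_scaleR) (simp add: field_simps)
    qed
    ultimately have "dist (integral {t..t + k} (\<lambda>s. S (t + k - s) (h s)) /\<^sub>R k) (h t) \<le> e / 2"
      using k(1) by (simp add: pos_divide_le_eq)
    then show ?thesis
      using \<open>0 < e\<close> by linarith
  qed
  show "\<forall>\<^sub>F k in at_right 0. dist (integral {t..t + k} (\<lambda>s. S (t + k - s) (h s)) /\<^sub>R k) (h t) < e"
    unfolding eventually_at_right_field
    using * \<open>0 < d\<close> \<open>t < b\<close> by (intro exI[of _ "min (d / 2) (b - t)"]) auto
qed

text \<open>For continuous \<open>h\<close> a mild solution need not be differentiable, so the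
  derivative is given and only its value is found. The generator controls limits from the right, and
  \<open>t < b\<close> leaves room there.\<close>

lemma mild_imp_derivative_eq:
  fixes S :: "real \<Rightarrow> 'a::banach \<Rightarrow>\<^sub>L 'a"
  assumes gen: "generates dom_A A S" and "0 \<le> t" "t < b" and h: "continuous_on {0..b} h"
    and mild: "\<And>s. s \<in> {t..b} \<Longrightarrow> y s = mild_solution S y0 h s"
    and dom: "y t \<in> dom_A" and y: "(y has_vector_derivative y') (at t)"
  shows "y' = A (y t) + h t"
proof -
  have S: "C0_semigroup S" and lim: "((\<lambda>k. (S k (y t) - y t) /\<^sub>R k) \<longlongrightarrow> A (y t)) (at_right 0)"
    using gen dom by (auto simp: generates_def)
  have "((\<lambda>k. (y (t + k) - y t) /\<^sub>R k) \<longlongrightarrow> y') (at_right 0)"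
    using y by (simp add: has_vector_derivative_at_iff_LIM filterlim_at_split)
  \<comment> \<open>Restarting at \<open>t\<close> writes the quotient of \<open>y\<close> as the
    generator quotient at \<open>y t\<close> plus an average of the forcing.\<close>
  moreover have "((\<lambda>k. (y (t + k) - y t) /\<^sub>R k) \<longlongrightarrow> A (y t) + h t) (at_right 0)"
  proof (rule Lim_transform_eventually)
    show "((\<lambda>k. (S k (y t) - y t) /\<^sub>R k + integral {t..t + k} (\<lambda>s. S (t + k - s) (h s)) /\<^sub>R k)
        \<longlongrightarrow> A (y t) + h t) (at_right 0)"
      using assms
      by (intro tendsto_add lim convolution_average_tendsto[OF S, of t b] continuous_on_subset[OF h])
        auto
    have "\<forall>\<^sub>F k in at_right 0. k < b - t"
      using \<open>t < b\<close> by (simp add: eventually_at_right_field) (metis diff_gt_0_iff_gt)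
    with eventually_at_right_less[of 0]
    show "\<forall>\<^sub>F k in at_right 0. (S k (y t) - y t) /\<^sub>R k
        + integral {t..t + k} (\<lambda>s. S (t + k - s) (h s)) /\<^sub>R k = (y (t + k) - y t) /\<^sub>R k"
    proof eventually_elim
      case (elim k)
      have "continuous_on {0..t + k} h"
        using elim by (intro continuous_on_subset[OF h]) auto
      then show ?case
        using mild_solution_add[OF S, of t k h y0] mild[of t] mild[of "t + k"] elim \<open>0 \<le> t\<close>
        by (simp add: scaleR_diff_right scaleR_add_right)
    qed
  qed
  ultimately show ?thesis
    by (rule tendsto_unique[OF trivial_limit_at_right_real])
qed

section \<open>Memory term and unresolved force\<close>

text \<open>The bounded \<open>B\<close> passes through the integral, and linearity in the forcing
  separates the response to \<open>x\<close>, which is the memory term, from the response to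
  \<open>y0\<close> and \<open>g\<close>, which is the unresolved force.\<close>

lemma memory_integral_eq_mild_solution:
  fixes S :: "real \<Rightarrow> 'u::banach \<Rightarrow>\<^sub>L 'u" and B :: "'u \<Rightarrow>\<^sub>L 'r::banach"
    and C :: "'r \<Rightarrow>\<^sub>L 'u"
  assumes S: "C0_semigroup S" and x: "continuous_on {0..t} x" and g: "continuous_on {0..t} g"
  shows "integral {0..t} (\<lambda>s. memory_kernel B S C (t - s) (x s)) + unresolved_force B S y0 g t
    = B (mild_solution S y0 (\<lambda>s. C (x s) + g s) t)"
proof -
  have "continuous_on {0..t} (\<lambda>s. C (x s))"
    by (intro continuous_intros x)
  then have intx: "(\<lambda>s. S (t - s) (C (x s))) integrable_on {0..t}"
    by (rule C0_semigroup_convolution_integrable[OF S _ order.refl])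
  have intg: "(\<lambda>s. S (t - s) (g s)) integrable_on {0..t}"
    by (rule C0_semigroup_convolution_integrable[OF S g order.refl])
  have "integral {0..t} (\<lambda>s. memory_kernel B S C (t - s) (x s))
      = B (integral {0..t} (\<lambda>s. S (t - s) (C (x s))))"
    using integral_linear[OF intx blinfun.bounded_linear_right[of B]]
    by (simp add: memory_kernel_def o_def)
  then show ?thesis
    by (simp add: mild_solution_def unresolved_force_def blinfun.add_right
        Henstock_Kurzweil_Integration.integral_add[OF intx intg])
qed

section \<open>Topology of the time interval\<close>

lemma time_interval_Icc_subset:
  assumes "t \<in> time_interval \<tau>"
  shows "{0..t} \<subseteq> time_interval \<tau>"
proof
  fix s assume "s \<in> {0..t}"
  then show "s \<in> time_interval \<tau>"
    using assms le_less_trans[of "ereal s" "ereal t" \<tau>] by (simp add: time_interval_def)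
qed

lemma interior_time_interval_pos:
  assumes "t \<in> interior (time_interval \<tau>)"
  shows "0 < t"
proof -
  have "time_interval \<tau> \<subseteq> {0..}"
    by (auto simp: time_interval_def)
  then have "t \<in> interior {0..}"
    using assms interior_mono by blast
  then show ?thesis
    by simp
qed

lemma interior_time_interval_Ioo_subset:
  assumes "t \<in> time_interval \<tau>"
  shows "{0<..<t} \<subseteq> interior (time_interval \<tau>)"
proof (rule interior_maximal)
  have "{0<..<t} \<subseteq> {0..t}"
    by auto
  then show "{0<..<t} \<subseteq> time_interval \<tau>"
    using time_interval_Icc_subset[OF assms] by simp
qed simp

text \<open>Provides the room to the right of an interior time that a right difference quotient
  requires.\<close>

lemma interior_time_interval_extend:
  assumes "t \<in> interior (time_interval \<tau>)"
  obtains b where "t < b" "b \<in> time_interval \<tau>"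
proof -
  obtain e where "0 < e" "cball t e \<subseteq> time_interval \<tau>"
    using assms by (auto simp: mem_interior_cball)
  then show ?thesis
    by (intro that[of "t + e"]) (auto simp: dist_real_def)
qed

section \<open>Elimination and recovery of the unresolved component\<close>

theorem proposition2p1:
  fixes A :: "'r::{real_inner, banach} \<Rightarrow> 'r"
    and D :: "'u::{real_inner, banach} \<Rightarrow> 'u"
    and dom_A :: "'r set" and dom_D :: "'u set"
    and S_A :: "real \<Rightarrow> 'r \<Rightarrow>\<^sub>L 'r" and S_D :: "real \<Rightarrow> 'u \<Rightarrow>\<^sub>L 'u"
    and B :: "'u \<Rightarrow>\<^sub>L 'r" and C :: "'r \<Rightarrow>\<^sub>L 'u"
    and \<tau> :: ereal and J :: "real set"
    and f :: "real \<Rightarrow> 'r" and g :: "real \<Rightarrow> 'u"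
    and x0 :: 'r and y0 :: 'u
  assumes "separable_space (euclidean :: 'r topology)"
    and "separable_space (euclidean :: 'u topology)"
    and "linear_operator dom_A A" and "generates dom_A A S_A"
    and "linear_operator dom_D D" and "generates dom_D D S_D"
    and "0 < \<tau>" and "J = time_interval \<tau>"
    and "continuous_on J f" and "continuous_on J g"
  shows "(\<forall>x y. block_solution J dom_A A B C dom_D D f g x0 y0 x y \<longrightarrow>
              memory_solution J dom_A A B C S_D f g x0 y0 x) \<and>
         (\<forall>x y. memory_solution J dom_A A B C S_D f g x0 y0 x \<longrightarrow>
              (\<forall>t\<in>J. y t = mild_solution S_D y0 (\<lambda>s. C (x s) + g s) t) \<longrightarrow>
              classical_regularity J dom_D y \<longrightarrow>
              block_solution J dom_A A B C dom_D D f g x0 y0 x y)"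
proof -
  note gen = \<open>generates dom_D D S_D\<close>
  then have S: "C0_semigroup S_D"
    by (simp add: generates_def)
  have sub: "{0..t} \<subseteq> J" if "t \<in> J" for t
    using that time_interval_Icc_subset \<open>J = time_interval \<tau>\<close> by blast
  have intJ: "t \<in> J" if "t \<in> interior J" for t
    using that interior_subset by blast
  \<comment> \<open>Both directions rest on this identity: the two equations for \<open>x\<close>
    differ only by whether \<open>B\<close> acts on \<open>y t\<close> or on the mild solution
    formula.\<close>
  have rhs_eq: "A (x t) + integral {0..t} (\<lambda>s. memory_kernel B S_D C (t - s) (x s))
      + unresolved_force B S_D y0 g t + f t
    = A (x t) + B (mild_solution S_D y0 (\<lambda>s. C (x s) + g s) t) + f t"
    if "continuous_on J x" "t \<in> interior J" for x t
    using memory_integral_eq_mild_solution[OF S, of t x g B C y0] that(1) \<open>continuous_on J g\<close>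
      sub[OF intJ[OF that(2)]]
    by (simp add: continuous_on_subset add.assoc)
  show ?thesis
  proof (intro conjI allI impI)
    fix x y
    assume block: "block_solution J dom_A A B C dom_D D f g x0 y0 x y"
    have contx: "continuous_on J x" and y: "continuous_on J y" "y 0 = y0"
      "\<And>t. t \<in> interior J \<Longrightarrow> y t \<in> dom_D"
      "\<And>t. t \<in> interior J \<Longrightarrow> (y has_vector_derivative D (y t) + (C (x t) + g t)) (at t)"
      using block by (auto simp: block_solution_def classical_solution_def
          classical_regularity_def algebra_simps)
    have y_eq: "y t = mild_solution S_D y0 (\<lambda>s. C (x s) + g s) t" if "t \<in> interior J" for t
    proof -
      have "{0<..<t} \<subseteq> interior J"
        using interior_time_interval_Ioo_subset intJ[OF that] \<open>J = time_interval \<tau>\<close> by blast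
      moreover have "0 \<le> t"
        using interior_time_interval_pos[of t \<tau>] that \<open>J = time_interval \<tau>\<close> by simp
      ultimately have "y t = mild_solution S_D (y 0) (\<lambda>s. C (x s) + g s) t"
        by (intro classical_imp_mild[OF gen] continuous_on_subset[OF y(1)] sub intJ that y(3,4))
          auto
      then show ?thesis
        by (simp only: y(2))
    qed
    show "memory_solution J dom_A A B C S_D f g x0 y0 x"
      using block
      by (simp add: block_solution_def memory_solution_def classical_solution_def
          rhs_eq[OF contx] y_eq)
  next
    fix x y
    assume mem: "memory_solution J dom_A A B C S_D f g x0 y0 x"
      and mild: "\<forall>t\<in>J. y t = mild_solution S_D y0 (\<lambda>s. C (x s) + g s) t"
      and reg: "classical_regularity J dom_D y"
    have contx: "continuous_on J x"
      using mem by (simp add: memory_solution_def classical_solution_def classical_regularity_def)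
    have "0 \<in> J"
      using \<open>0 < \<tau>\<close> \<open>J = time_interval \<tau>\<close> by (simp add: time_interval_def zero_ereal_def)
    then have "y 0 = y0"
      using mild by (simp add: mild_solution_def C0_semigroup_0[OF S])
    have "(y has_vector_derivative C (x t) + D (y t) + g t) (at t)" if t: "t \<in> interior J" for t
    proof -
      obtain b where b: "t < b" "b \<in> J"
        using interior_time_interval_extend t \<open>J = time_interval \<tau>\<close> by blast
      have "0 < t"
        using interior_time_interval_pos t \<open>J = time_interval \<tau>\<close> by blast
      \<comment> \<open>Existence of the derivative comes from the assumed regularity; its value
        then follows from the mild formula on \<open>{t..b}\<close>.\<close>
      obtain y' where y': "(y has_vector_derivative y') (at t)"
        using reg t by (auto simp: classical_regularity_def C1_differentiable_on_def)
      have "continuous_on {0..b} x" "continuous_on {0..b} g"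
        using sub[OF b(2)] contx \<open>continuous_on J g\<close> continuous_on_subset by blast+
      then have "continuous_on {0..b} (\<lambda>s. C (x s) + g s)"
        by (intro continuous_intros)
      then have "y' = D (y t) + (C (x t) + g t)"
      proof (rule mild_imp_derivative_eq[OF gen less_imp_le[OF \<open>0 < t\<close>] b(1) _ _ _ y'])
        show "y s = mild_solution S_D y0 (\<lambda>s. C (x s) + g s) s" if "s \<in> {t..b}" for s
        proof -
          have "s \<in> J"
            using sub[OF b(2)] \<open>0 < t\<close> that by auto
          then show ?thesis
            using mild by blast
        qed
        show "y t \<in> dom_D"
          using reg t by (simp add: classical_regularity_def)
      qed
      then show ?thesis
        using y' by (simp add: algebra_simps)
    qed
    \<comment> \<open>At interior times the mild formula identifies \<open>y t\<close>, so
      \<open>rhs_eq\<close> turns the memory equation for \<open>x\<close> into its block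
      form.\<close>
    then show "block_solution J dom_A A B C dom_D D f g x0 y0 x y"
      using mem reg \<open>y 0 = y0\<close> mild intJ
      by (simp add: block_solution_def memory_solution_def classical_solution_def
          rhs_eq[OF contx])
  qed
qed

end
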